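(* There is a time-like $2$-regular curve in $\mathbb{L}^4$ that does not admit a generalized Bishop frame of type F.
   Context: $\mathbb{L}^4$ is $\mathbb{R}^4$ with the Lorentzian inner product $\langle\cdot,\cdot\rangle$ of signature $(-,+,+,+)$. Curves $\gamma: I\to\mathbb{L}^4$ are smooth and defined on an open interval $I$. A regular time-like curve is one with $\langle\gamma',\gamma'\rangle<0$ everywhere. It is parametrized by proper time $s$, so that $\mathbb{T}=\gamma'$ satisfies $\langle\mathbb{T},\mathbb{T}\rangle=-1$, and $'$ denotes $d/ds$. A time-like curve is called $2$-regular if both its tangent vector $\mathbb{T}$ and the derivative $\mathbb{T}'$ are nowhere zero. An orthonormal frame of $\gamma$ is a smooth family $\{\mathbb{T},\mathbb{Z}_1,\mathbb{Z}_2,\mathbb{Z}_3\}$ along $\gamma$ whose first vector is $\mathbb{T}$, with $\langle\mathbb{T},\mathbb{Z}_i\rangle=0$ and $\langle\mathbb{Z}_i,\mathbb{Z}_j\rangle=\delta_{ij}$. Writing $\mathbb{Z}$ for the matrix with rows $\mathbb{T},\mathbb{Z}_1,\mathbb{Z}_2,\mathbb{Z}_3$, its coefficient matrix is the matrix-valued function $X$ with $\mathbb{Z}'=X\mathbb{Z}$. The frame is called a generalized Bishop frame of type F if, after some permutation of the last three vectors, its coefficient matrix has the form $$\begin{pmatrix}0&x_1&0&0\\ x_1&0&x_2&0\\ 0&-x_2&0&x_3\\ 0&0&-x_3&0\end{pmatrix}$$ for some smooth functions $x_1,x_2,x_3$ on $I$ (zeros allowed). *)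

theory Defs
  imports "HOL-Analysis.Analysis"
begin

definition lorentz :: "real^4 \<Rightarrow> real^4 \<Rightarrow> real" where
  "lorentz x y = - (x $ 1 * y $ 1) + x $ 2 * y $ 2 + x $ 3 * y $ 3 + x $ 4 * y $ 4"

definition open_interval :: "real set \<Rightarrow> bool" where
  "open_interval I \<longleftrightarrow> open I \<and> is_interval I \<and> I \<noteq> {}"

text \<open>A map defined on an open set \<open>I\<close> is represented by a total function whose values outside \<open>I\<close>
  are irrelevant: derivatives at points of the open set \<open>I\<close> see only the values on \<open>I\<close>.\<close>

definition nth_vector_derivative :: "nat \<Rightarrow> (real \<Rightarrow> 'a::real_normed_vector) \<Rightarrow> real \<Rightarrow> 'a" where
  "nth_vector_derivative n f = ((\<lambda>g s. vector_derivative g (at s)) ^^ n) f"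

definition smooth_on :: "real set \<Rightarrow> (real \<Rightarrow> 'a::real_normed_vector) \<Rightarrow> bool" where
  "smooth_on I f \<longleftrightarrow> (\<forall>n. \<forall>s\<in>I. nth_vector_derivative n f differentiable (at s))"

definition tangent :: "(real \<Rightarrow> real^4) \<Rightarrow> real \<Rightarrow> real^4" where
  "tangent \<gamma> s = vector_derivative \<gamma> (at s)"

definition regular_timelike_curve :: "real set \<Rightarrow> (real \<Rightarrow> real^4) \<Rightarrow> bool" where
  "regular_timelike_curve I \<gamma> \<longleftrightarrow>
     open_interval I \<and> smooth_on I \<gamma> \<and> (\<forall>s\<in>I. lorentz (tangent \<gamma> s) (tangent \<gamma> s) < 0)"

definition proper_time_parametrized :: "real set \<Rightarrow> (real \<Rightarrow> real^4) \<Rightarrow> bool" where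
  "proper_time_parametrized I \<gamma> \<longleftrightarrow> (\<forall>s\<in>I. lorentz (tangent \<gamma> s) (tangent \<gamma> s) = -1)"

definition two_regular :: "real set \<Rightarrow> (real \<Rightarrow> real^4) \<Rightarrow> bool" where
  "two_regular I \<gamma> \<longleftrightarrow>
     (\<forall>s\<in>I. tangent \<gamma> s \<noteq> 0 \<and> vector_derivative (tangent \<gamma>) (at s) \<noteq> 0)"

text \<open>A frame is stored as the matrix \<open>Z s\<close> with rows \<open>Z s $ 1 = T\<close> and
  \<open>Z s $ 2, Z s $ 3, Z s $ 4 = Z\<^sub>1, Z\<^sub>2, Z\<^sub>3\<close>; in the index type \<open>4\<close> the numerals
  \<open>1, 2, 3, 4\<close> are the four distinct elements.\<close>

definition orthonormal_frame :: "real set \<Rightarrow> (real \<Rightarrow> real^4) \<Rightarrow> (real \<Rightarrow> real^4^4) \<Rightarrow> bool" where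
  "orthonormal_frame I \<gamma> Z \<longleftrightarrow>
     smooth_on I Z \<and>
     (\<forall>s\<in>I. Z s $ 1 = tangent \<gamma> s \<and>
        (\<forall>i\<in>{2,3,4}. lorentz (Z s $ 1) (Z s $ i) = 0) \<and>
        (\<forall>i\<in>{2,3,4}. \<forall>j\<in>{2,3,4}. lorentz (Z s $ i) (Z s $ j) = (if i = j then 1 else 0)))"

definition coefficient_matrix ::
    "real set \<Rightarrow> (real \<Rightarrow> real^4^4) \<Rightarrow> (real \<Rightarrow> real^4^4) \<Rightarrow> bool" where
  "coefficient_matrix I Z X \<longleftrightarrow> (\<forall>s\<in>I. (Z has_vector_derivative (X s ** Z s)) (at s))"

definition type_F_matrix :: "real \<Rightarrow> real \<Rightarrow> real \<Rightarrow> real^4^4" where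
  "type_F_matrix a b c = vector
     [vector [0,  a,  0, 0],
      vector [a,  0,  b, 0],
      vector [0, -b,  0, c],
      vector [0,  0, -c, 0]]"

definition generalized_Bishop_frame_F ::
    "real set \<Rightarrow> (real \<Rightarrow> real^4) \<Rightarrow> (real \<Rightarrow> real^4^4) \<Rightarrow> bool" where
  "generalized_Bishop_frame_F I \<gamma> Z \<longleftrightarrow>
     orthonormal_frame I \<gamma> Z \<and>
     (\<exists>\<sigma> x1 x2 x3. \<sigma> permutes {2, 3, 4 :: 4} \<and>
        smooth_on I x1 \<and> smooth_on I x2 \<and> smooth_on I x3 \<and>
        coefficient_matrix I (\<lambda>s. \<chi> i. Z s $ \<sigma> i) (\<lambda>s. type_F_matrix (x1 s) (x2 s) (x3 s)))"

end

theory Submission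
  imports Defs
begin

text \<open>Let \<open>f\<close> be the flat function that is \<open>exp (-1/s)\<close> for \<open>s > 0\<close> and \<open>0\<close> for \<open>s \<le> 0\<close>, and let
  \<open>g s = f (-s)\<close>. The curve is a primitive on \<open>(-1/2, 1/2)\<close> of the path
  \<open>T = (\<surd>(1 + s\<^sup>2 + f\<^sup>2 + g\<^sup>2), s, f, g)\<close> in hyperbolic space, which leaves the hyperbolic line
  \<open>f = g = 0\<close> into one plane for \<open>s > 0\<close> and into an orthogonal plane for \<open>s < 0\<close>; all contacts at
  \<open>s = 0\<close> are of infinite order, so \<open>T\<close> is smooth.

  In a frame of type F the vector in second place is forced up to sign, being the normalization of
  \<open>T'\<close>, and the one in third place, \<open>B\<close>, satisfies \<open>T'' = a T + c T' + x\<^sub>1 x\<^sub>2 B\<close> with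
  \<open>a = x\<^sub>1\<^sup>2 > 0\<close> (\<open>tangent_second_derivative\<close>). A convexity argument (\<open>flat_0_convex\<close>) shows that
  \<open>x\<^sub>2\<close> vanishes at no \<open>s \<noteq> 0\<close>. Hence \<open>B\<close> lies in the span of \<open>T, T', T''\<close> there, so its fourth
  component vanishes for \<open>s > 0\<close> and its third one for \<open>s < 0\<close>. By continuity both vanish at \<open>0\<close>,
  where orthogonality to \<open>T\<close> and \<open>T'\<close> kills the other two components as well: \<open>B 0 = 0\<close>,
  contradicting that \<open>B\<close> is a unit vector (\<open>no_type_F_frame\<close>).\<close>

section \<open>Smoothness from a class of functions closed under differentiation\<close>

text \<open>Coinduction for smoothness: every iterated derivative of a function in \<open>P\<close> agrees on \<open>I\<close> with
  a member of \<open>P\<close>. Openness of \<open>I\<close> makes agreement on \<open>I\<close> enough for the next derivative.\<close>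

lemma smooth_on_coinduct:
  fixes f :: "real \<Rightarrow> 'a::real_normed_vector"
  assumes "open I" and "P f"
    and closed: "\<And>g. P g \<Longrightarrow> \<exists>g'. P g' \<and> (\<forall>s\<in>I. (g has_vector_derivative g' s) (at s))"
  shows "smooth_on I f"
proof -
  have step: "\<exists>g'. P g' \<and> (\<forall>s\<in>I. (nth_vector_derivative n f has_vector_derivative g' s) (at s))"
    if "P g" "\<forall>s\<in>I. nth_vector_derivative n f s = g s" for n g
  proof -
    obtain g' where g': "P g'" "\<forall>s\<in>I. (g has_vector_derivative g' s) (at s)"
      using closed[OF \<open>P g\<close>] by blast
    have "(nth_vector_derivative n f has_vector_derivative g' s) (at s)" if "s \<in> I" for s
      by (rule has_vector_derivative_transform_within_open[OF g'(2)[rule_format, OF that] \<open>open I\<close> that])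
        (simp add: \<open>\<forall>s\<in>I. nth_vector_derivative n f s = g s\<close>)
    with g'(1) show ?thesis by blast
  qed
  have agree: "\<exists>g. P g \<and> (\<forall>s\<in>I. nth_vector_derivative n f s = g s)" for n
  proof (induction n)
    case 0
    then show ?case using \<open>P f\<close> by (auto simp: nth_vector_derivative_def)
  next
    case (Suc n)
    then obtain g where "P g" "\<forall>s\<in>I. nth_vector_derivative n f s = g s" by blast
    from step[OF this] obtain g' where g': "P g'"
      "\<forall>s\<in>I. (nth_vector_derivative n f has_vector_derivative g' s) (at s)"
      by blast
    have "nth_vector_derivative (Suc n) f = (\<lambda>s. vector_derivative (nth_vector_derivative n f) (at s))"
      by (simp add: nth_vector_derivative_def)
    then have "\<forall>s\<in>I. nth_vector_derivative (Suc n) f s = g' s"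
      using g'(2) by (simp add: vector_derivative_at)
    with g'(1) show ?case by blast
  qed
  show ?thesis
    unfolding smooth_on_def
  proof (intro allI ballI)
    fix n s assume "s \<in> I"
    obtain g where "P g" "\<forall>s\<in>I. nth_vector_derivative n f s = g s" using agree by blast
    from step[OF this] \<open>s \<in> I\<close> show "nth_vector_derivative n f differentiable (at s)"
      by (blast intro: differentiableI_vector)
  qed
qed

lemma smooth_on_differentiable: "smooth_on I f \<Longrightarrow> s \<in> I \<Longrightarrow> f differentiable (at s)"
  unfolding smooth_on_def nth_vector_derivative_def by (metis funpow_0)

text \<open>The functions \<open>exp (-1/s) / s ^ k\<close>, extended by zero: up to linear combination, the derivatives
  of the flat function \<open>flat 0\<close>.\<close>

definition flat :: "nat \<Rightarrow> real \<Rightarrow> real" where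
  "flat k s = (if s \<le> 0 then 0 else exp (-(1/s)) / s ^ k)"

lemma flat_tendsto_0: "(flat k \<longlongrightarrow> 0) (at 0)"
proof (rule filterlim_split_at)
  have "\<forall>\<^sub>F s in at_left (0::real). 0 = flat k s"
    by (auto simp: eventually_at_filter flat_def)
  then show "(flat k \<longlongrightarrow> 0) (at_left 0)"
    using tendsto_cong tendsto_const by fastforce
next
  have "((\<lambda>s::real. (inverse s) ^ k / exp (inverse s)) \<longlongrightarrow> 0) (at_right 0)"
    using filterlim_compose[OF tendsto_power_div_exp_0 filterlim_inverse_at_top_right] .
  moreover have "\<forall>\<^sub>F s in at_right (0::real). (inverse s) ^ k / exp (inverse s) = flat k s"
    by (auto simp: eventually_at_filter flat_def exp_minus field_simps)
  ultimately show "(flat k \<longlongrightarrow> 0) (at_right 0)"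
    using tendsto_cong by fastforce
qed

lemma flat_has_derivative:
  "(flat k has_real_derivative flat (k + 2) s - real k * flat (k + 1) s) (at s)"
proof -
  consider "s < 0" | "s = 0" | "s > 0" by linarith
  then show ?thesis
  proof cases
    case 1
    have "(flat k has_real_derivative 0) (at s)"
      by (rule has_field_derivative_transform_within_open[of "\<lambda>_. 0" _ _ "{..<0}"])
        (use 1 in \<open>auto simp: flat_def\<close>)
    then show ?thesis using 1 by (simp add: flat_def)
  next
    case 2
    \<comment> \<open>The difference quotient of \<open>flat k\<close> at \<open>0\<close> is \<open>flat (k + 1)\<close>.\<close>
    have "((\<lambda>y. (flat k y - flat k 0) / (y - 0)) \<longlongrightarrow> 0) (at 0)"
      by (rule Lim_transform_eventually[OF flat_tendsto_0[of "k + 1"]])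
        (auto simp: eventually_at_filter flat_def)
    then show ?thesis using 2 by (simp add: has_field_derivative_iff flat_def)
  next
    case 3
    have "((\<lambda>s. s ^ k) has_real_derivative real k * (s ^ k / s)) (at s)"
      using 3 DERIV_pow[of k s] by (cases k) auto
    moreover have "((\<lambda>s. exp (-(1/s))) has_real_derivative exp (-(1/s)) / s\<^sup>2) (at s)"
      using 3 by (auto intro!: derivative_eq_intros simp: field_simps power2_eq_square)
    ultimately have "((\<lambda>s. exp (-(1/s)) / s ^ k) has_real_derivative
        (exp (-(1/s)) / s\<^sup>2 * s ^ k - exp (-(1/s)) * (real k * (s ^ k / s))) / (s ^ k * s ^ k)) (at s)"
      using 3 by (intro DERIV_divide) auto
    also have "(exp (-(1/s)) / s\<^sup>2 * s ^ k - exp (-(1/s)) * (real k * (s ^ k / s))) / (s ^ k * s ^ k) =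
        flat (k + 2) s - real k * flat (k + 1) s"
      using 3 by (simp add: flat_def field_simps power2_eq_square)
    finally have "((\<lambda>s. exp (-(1/s)) / s ^ k) has_real_derivative
        flat (k + 2) s - real k * flat (k + 1) s) (at s)" .
    then show ?thesis
      by (rule has_field_derivative_transform_within_open[of _ _ _ "{0<..}"])
        (use 3 in \<open>auto simp: flat_def\<close>)
  qed
qed

text \<open>An algebra that is closed under differentiation and contains the components of the tangent
  vector constructed below. The real exponent in \<open>powr\<close> provides the square root and makes the
  derivative of such a power of the same form.\<close>

inductive_set elementary :: "(real \<Rightarrow> real) set" where
  const: "(\<lambda>_. c) \<in> elementary"
| ident: "(\<lambda>s. s) \<in> elementary"
| flat: "flat k \<in> elementary"
| reflect: "f \<in> elementary \<Longrightarrow> (\<lambda>s. f (- s)) \<in> elementary"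
| add: "f \<in> elementary \<Longrightarrow> g \<in> elementary \<Longrightarrow> (\<lambda>s. f s + g s) \<in> elementary"
| mult: "f \<in> elementary \<Longrightarrow> g \<in> elementary \<Longrightarrow> (\<lambda>s. f s * g s) \<in> elementary"
| powr: "f \<in> elementary \<Longrightarrow> (\<And>s. f s > 0) \<Longrightarrow> (\<lambda>s. f s powr c) \<in> elementary"

lemma elementary_derivative:
  "f \<in> elementary \<Longrightarrow> \<exists>f'\<in>elementary. \<forall>s. (f has_real_derivative f' s) (at s)"
proof (induction rule: elementary.induct)
  case (const c)
  then show ?case by (intro bexI[of _ "\<lambda>_. 0"] elementary.const) auto
next
  case ident
  then show ?case by (intro bexI[of _ "\<lambda>_. 1"] elementary.const) auto
next
  case (flat k)
  have "(\<lambda>s. flat (k + 2) s + (- real k) * flat (k + 1) s) \<in> elementary"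
    by (intro elementary.add elementary.mult elementary.const elementary.flat)
  moreover have "(flat k has_real_derivative (flat (k + 2) s + (- real k) * flat (k + 1) s)) (at s)" for s
    using flat_has_derivative[of k s] by simp
  ultimately show ?case
    by (intro bexI[of _ "\<lambda>s. flat (k + 2) s + (- real k) * flat (k + 1) s"]) auto
next
  case (reflect f)
  then obtain f' where f': "f' \<in> elementary" "\<And>s. (f has_real_derivative f' s) (at s)" by blast
  have "((\<lambda>s. f (- s)) has_real_derivative (- 1) * f' (- s)) (at s)" for s
    using f'(2)[of "-s"] by (simp add: DERIV_mirror)
  moreover have "(\<lambda>s. (- 1) * f' (- s)) \<in> elementary"
    by (intro elementary.mult elementary.const elementary.reflect f'(1))
  ultimately show ?case by (intro bexI[of _ "\<lambda>s. (- 1) * f' (- s)"]) auto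
next
  case (add f g)
  then obtain f' g' where "f' \<in> elementary" "\<And>s. (f has_real_derivative f' s) (at s)"
    "g' \<in> elementary" "\<And>s. (g has_real_derivative g' s) (at s)" by blast
  then show ?case
    by (intro bexI[of _ "\<lambda>s. f' s + g' s"] allI DERIV_add elementary.add)
next
  case (mult f g)
  then obtain f' g' where "f' \<in> elementary" "\<And>s. (f has_real_derivative f' s) (at s)"
    "g' \<in> elementary" "\<And>s. (g has_real_derivative g' s) (at s)" by blast
  then show ?case using mult.hyps
    by (intro bexI[of _ "\<lambda>s. f' s * g s + g' s * f s"] allI DERIV_mult elementary.add elementary.mult)
next
  case (powr f c)
  then obtain f' where f': "f' \<in> elementary" "\<And>s. (f has_real_derivative f' s) (at s)" by blast
  have "((\<lambda>s. f s powr c) has_real_derivative c * f s powr (c - 1) * f' s) (at s)" for s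
    by (rule DERIV_chain2[OF has_real_derivative_powr f'(2)]) (rule powr.hyps)
  moreover have "(\<lambda>s. c * f s powr (c - 1) * f' s) \<in> elementary"
    by (intro elementary.mult elementary.const elementary.powr f'(1) powr.hyps)
  ultimately show ?case by (intro bexI[of _ "\<lambda>s. c * f s powr (c - 1) * f' s"] allI)
qed

lemma has_vector_derivative_vec_iff:
  fixes v :: "real \<Rightarrow> real^'n"
  shows "(v has_vector_derivative d) (at s) \<longleftrightarrow>
    (\<forall>i. ((\<lambda>s. v s $ i) has_real_derivative d $ i) (at s))"
proof -
  have "(v has_vector_derivative d) (at s) \<longleftrightarrow>
      (\<forall>b\<in>Basis. ((\<lambda>s. v s \<bullet> b) has_vector_derivative d \<bullet> b) (at s))"
    using has_derivative_componentwise_within[of v "\<lambda>h. h *\<^sub>R d" s UNIV]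
    by (simp add: has_vector_derivative_def)
  also have "\<dots> \<longleftrightarrow> (\<forall>i. ((\<lambda>s. v s $ i) has_vector_derivative d $ i) (at s))"
    by (auto simp: Basis_vec_def inner_axis)
  finally show ?thesis
    by (simp add: has_real_derivative_iff_has_vector_derivative)
qed

lemma elementary_vec_derivative:
  fixes v :: "real \<Rightarrow> real^'n"
  assumes "\<forall>i. (\<lambda>s. v s $ i) \<in> elementary"
  shows "\<exists>v'. (\<forall>i. (\<lambda>s. v' s $ i) \<in> elementary) \<and> (\<forall>s. (v has_vector_derivative v' s) (at s))"
proof -
  have "\<forall>i. \<exists>d. d \<in> elementary \<and> (\<forall>s. ((\<lambda>s. v s $ i) has_real_derivative d s) (at s))"
    using elementary_derivative[OF assms[rule_format]] by blast
  from choice[OF this] obtain d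
    where "\<And>i. d i \<in> elementary \<and> (\<forall>s. ((\<lambda>s. v s $ i) has_real_derivative d i s) (at s))"
    by blast
  then show ?thesis
    by (intro exI[of _ "\<lambda>s. \<chi> i. d i s"]) (auto simp: has_vector_derivative_vec_iff)
qed

section \<open>Consequences of a Bishop frame of type F\<close>

text \<open>The permutation of the last three frame vectors is absorbed into the choice of the normals
  \<open>N\<close> and \<open>B\<close>: the vectors in second and third place after permuting.\<close>

lemma type_F_normals:
  assumes "generalized_Bishop_frame_F I \<gamma> Z" and "open I"
  obtains N B x1 x2 where
    "\<And>s. s \<in> I \<Longrightarrow> (tangent \<gamma> has_vector_derivative x1 s *\<^sub>R N s) (at s)"
    "\<And>s. s \<in> I \<Longrightarrow> (N has_vector_derivative x1 s *\<^sub>R tangent \<gamma> s + x2 s *\<^sub>R B s) (at s)"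
    "\<And>s. s \<in> I \<Longrightarrow> x1 differentiable (at s)"
    "\<And>s. s \<in> I \<Longrightarrow> isCont B s"
    "\<And>s. s \<in> I \<Longrightarrow> lorentz (tangent \<gamma> s) (B s) = 0 \<and> lorentz (N s) (B s) = 0 \<and> lorentz (B s) (B s) = 1"
proof -
  obtain \<sigma> x1 x2 x3 where \<sigma>: "\<sigma> permutes {2, 3, 4 :: 4}"
    and x1: "smooth_on I x1"
    and coeff: "coefficient_matrix I (\<lambda>s. \<chi> i. Z s $ \<sigma> i) (\<lambda>s. type_F_matrix (x1 s) (x2 s) (x3 s))"
    and frame: "orthonormal_frame I \<gamma> Z"
    using assms(1) unfolding generalized_Bishop_frame_F_def by blast
  have \<sigma>1: "\<sigma> 1 = 1"
    by (rule permutes_not_in[OF \<sigma>]) simp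
  have \<sigma>23: "\<sigma> 2 \<in> {2,3,4}" "\<sigma> 3 \<in> {2,3,4}"
    using permutes_in_image[OF \<sigma>] by auto
  have "\<sigma> 2 \<noteq> \<sigma> 3"
    using permutes_inj[OF \<sigma>] by (simp add: inj_eq)
  define A where "A = (\<lambda>s. \<chi> i. Z s $ \<sigma> i)"
  have A1: "A s $ 1 = tangent \<gamma> s" if "s \<in> I" for s
    using frame that by (simp add: A_def \<sigma>1 orthonormal_frame_def)
  have A': "((\<lambda>s. A s $ i) has_vector_derivative
      (type_F_matrix (x1 s) (x2 s) (x3 s) ** A s) $ i) (at s)" if "s \<in> I" for i s
    using bounded_linear.has_vector_derivative[OF bounded_linear_vec_nth] coeff that
    unfolding coefficient_matrix_def A_def by blast
  have row1: "(type_F_matrix (x1 s) (x2 s) (x3 s) ** A s) $ 1 = x1 s *\<^sub>R A s $ 2" for s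
    by (simp add: vec_eq_iff matrix_matrix_mult_def type_F_matrix_def sum_4 vector_def)
  have row2: "(type_F_matrix (x1 s) (x2 s) (x3 s) ** A s) $ 2 =
      x1 s *\<^sub>R A s $ 1 + x2 s *\<^sub>R A s $ 3" for s
    by (simp add: vec_eq_iff matrix_matrix_mult_def type_F_matrix_def sum_4 vector_def)
  show thesis
  proof (rule that)
    fix s assume s: "s \<in> I"
    show "(tangent \<gamma> has_vector_derivative x1 s *\<^sub>R A s $ 2) (at s)"
      using has_vector_derivative_transform_within_open[OF A'[OF s, of 1] \<open>open I\<close> s A1]
      by (simp add: row1)
    show "((\<lambda>s. A s $ 2) has_vector_derivative x1 s *\<^sub>R tangent \<gamma> s + x2 s *\<^sub>R A s $ 3) (at s)"
      using A'[OF s, of 2] by (simp add: row2 A1[OF s])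
    show "x1 differentiable (at s)"
      using smooth_on_differentiable x1 s by blast
    show "isCont (\<lambda>s. A s $ 3) s"
      by (rule has_vector_derivative_continuous[OF A'[OF s, of 3]])
    show "lorentz (tangent \<gamma> s) (A s $ 3) = 0 \<and> lorentz (A s $ 2) (A s $ 3) = 0 \<and>
        lorentz (A s $ 3) (A s $ 3) = 1"
    proof -
      have "lorentz (Z s $ 1) (Z s $ i) = 0" if "i \<in> {2,3,4}" for i
        using frame s that unfolding orthonormal_frame_def by blast
      moreover have "lorentz (Z s $ i) (Z s $ j) = (if i = j then 1 else 0)"
        if "i \<in> {2,3,4}" "j \<in> {2,3,4}" for i j
        using frame s that unfolding orthonormal_frame_def by blast
      ultimately show ?thesis
        using \<sigma>23 \<open>\<sigma> 2 \<noteq> \<sigma> 3\<close> by (simp add: A_def \<sigma>1 flip: A1[OF s])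
    qed
  qed
qed

text \<open>Differentiating \<open>T' = x\<^sub>1 N\<close> once more. The coefficient of \<open>T\<close> is a square, hence positive
  where \<open>T'\<close> does not vanish.\<close>

lemma tangent_second_derivative:
  fixes T N B :: "real \<Rightarrow> real^4"
  assumes "open I" "s \<in> I"
    and T: "\<And>s. s \<in> I \<Longrightarrow> (T has_vector_derivative x1 s *\<^sub>R N s) (at s)"
    and N: "(N has_vector_derivative x1 s *\<^sub>R T s + x2 *\<^sub>R b) (at s)"
    and x1: "x1 differentiable (at s)"
    and D: "\<And>s. s \<in> I \<Longrightarrow> (T has_vector_derivative D s) (at s)" "D s \<noteq> 0"
    and E: "(D has_vector_derivative e) (at s)"
  shows "\<exists>a c. a > 0 \<and> e = a *\<^sub>R T s + c *\<^sub>R D s + (x1 s * x2) *\<^sub>R b"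
proof -
  have DN: "D s = x1 s *\<^sub>R N s" if "s \<in> I" for s
    by (rule vector_derivative_unique_at[OF D(1)[OF that] T[OF that]])
  obtain y where y: "(x1 has_real_derivative y) (at s)"
    using x1 real_differentiableE by blast
  have "((\<lambda>s. x1 s *\<^sub>R N s) has_vector_derivative
      x1 s *\<^sub>R (x1 s *\<^sub>R T s + x2 *\<^sub>R b) + y *\<^sub>R N s) (at s)"
    by (rule has_vector_derivative_scaleR[OF y N])
  then have "(D has_vector_derivative x1 s *\<^sub>R (x1 s *\<^sub>R T s + x2 *\<^sub>R b) + y *\<^sub>R N s) (at s)"
    by (rule has_vector_derivative_transform_within_open[OF _ \<open>open I\<close> \<open>s \<in> I\<close>]) (simp add: DN)
  then have "e = x1 s *\<^sub>R (x1 s *\<^sub>R T s + x2 *\<^sub>R b) + y *\<^sub>R N s"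
    by (rule vector_derivative_unique_at[OF E])
  moreover have "x1 s \<noteq> 0" using D(2) DN[OF \<open>s \<in> I\<close>] by auto
  ultimately have "e = (x1 s)\<^sup>2 *\<^sub>R T s + (y / x1 s) *\<^sub>R D s + (x1 s * x2) *\<^sub>R b"
    by (simp add: DN[OF \<open>s \<in> I\<close>] algebra_simps power2_eq_square)
  with \<open>x1 s \<noteq> 0\<close> show ?thesis
    by (intro exI[of _ "(x1 s)\<^sup>2"] exI[of _ "y / x1 s"]) auto
qed

section \<open>A curve with jumping osculating space\<close>

text \<open>The first component is determined by the others through \<open>\<langle>T, T\<rangle> = -1\<close>. Taking \<open>s\<close> itself as the
  second one makes \<open>T'\<close> nowhere zero.\<close>

definition bent_tangent :: "real \<Rightarrow> real^4" where
  "bent_tangent s = (\<chi> i. if i = 1 then (1 + s * s + flat 0 s * flat 0 s + flat 0 (-s) * flat 0 (-s)) powr (1/2)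
     else if i = 2 then s else if i = 3 then flat 0 s else flat 0 (-s))"

lemma bent_tangent_nth:
  "bent_tangent s $ 2 = s" "bent_tangent s $ 3 = flat 0 s" "bent_tangent s $ 4 = flat 0 (-s)"
  by (simp_all add: bent_tangent_def)

lemma bent_tangent_elementary: "\<forall>i. (\<lambda>s. bent_tangent s $ i) \<in> elementary"
proof -
  have "(\<lambda>s. (1 + s * s + flat 0 s * flat 0 s + flat 0 (-s) * flat 0 (-s)) powr (1/2)) \<in> elementary"
    by (intro elementary.powr elementary.add elementary.mult elementary.const elementary.ident
        elementary.flat elementary.reflect[OF elementary.flat]) (simp add: add_pos_nonneg)
  then have "(\<lambda>s. bent_tangent s $ 1) \<in> elementary"
    by (simp add: bent_tangent_def)
  then show ?thesis
    by (simp add: forall_4 bent_tangent_nth elementary.ident elementary.flat elementary.reflect)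
qed

lemma lorentz_bent_tangent: "lorentz (bent_tangent s) (bent_tangent s) = -1"
proof -
  have "0 < 1 + s * s + flat 0 s * flat 0 s + flat 0 (-s) * flat 0 (-s)"
    by (simp add: add_pos_nonneg)
  then show ?thesis
    by (simp add: lorentz_def bent_tangent_def flip: powr_add)
qed

text \<open>The relation \<open>f'' = a (f - s f')\<close> with \<open>a > 0\<close> is what the components of \<open>T'' = a T + c T'\<close>
  give if one component of \<open>T\<close> is \<open>s\<close>. A strictly convex function vanishing at \<open>0\<close> violates it:
  its tangent lines pass below the origin.\<close>

lemma flat_0_convex:
  assumes "0 < s" "s < 1/2"
  shows "flat 4 s - 2 * flat 3 s > 0" "flat 0 s - s * flat 2 s < 0"
proof -
  have "flat 4 s - 2 * flat 3 s = exp (-(1/s)) / s ^ 4 * (1 - 2 * s)"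
    using assms by (simp add: flat_def field_simps eval_nat_numeral)
  then show "flat 4 s - 2 * flat 3 s > 0" using assms by simp
  have "flat 0 s - s * flat 2 s = exp (-(1/s)) / s * (s - 1)"
    using assms by (simp add: flat_def field_simps eval_nat_numeral)
  then show "flat 0 s - s * flat 2 s < 0" using assms
    by (simp add: mult_pos_neg divide_neg_pos)
qed

lemma flat_0_derivatives:
  "(flat 0 has_real_derivative flat 2 s) (at s)"
  "((\<lambda>s. flat 0 (-s)) has_real_derivative - flat 2 (-s)) (at s)"
  "(flat 2 has_real_derivative flat 4 s - 2 * flat 3 s) (at s)"
  "((\<lambda>s. - flat 2 (-s)) has_real_derivative flat 4 (-s) - 2 * flat 3 (-s)) (at s)"
proof -
  have 1: "(flat 0 has_real_derivative flat 2 s) (at s)" for s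
    using flat_has_derivative[of 0 s] by (simp add: eval_nat_numeral)
  have 2: "(flat 2 has_real_derivative flat 4 s - 2 * flat 3 s) (at s)" for s
    using flat_has_derivative[of 2 s] by (simp add: eval_nat_numeral)
  show "(flat 0 has_real_derivative flat 2 s) (at s)"
    "(flat 2 has_real_derivative flat 4 s - 2 * flat 3 s) (at s)"
    by (rule 1 2)+
  show "((\<lambda>s. flat 0 (-s)) has_real_derivative - flat 2 (-s)) (at s)"
    using 1[of "-s"] by (simp add: DERIV_mirror)
  show "((\<lambda>s. - flat 2 (-s)) has_real_derivative flat 4 (-s) - 2 * flat 3 (-s)) (at s)"
    using DERIV_minus[OF 2[of "-s", unfolded DERIV_mirror]] by simp
qed

text \<open>The time component of the derivatives is left unspecified: the three spatial components suffice
  to exclude a frame.\<close>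

lemma bent_tangent_derivatives:
  obtains D E where
    "\<And>s. (bent_tangent has_vector_derivative D s) (at s)"
    "\<And>s. (D has_vector_derivative E s) (at s)"
    "\<And>s. D s $ 2 = 1 \<and> D s $ 3 = flat 2 s \<and> D s $ 4 = - flat 2 (-s)"
    "\<And>s. E s $ 2 = 0 \<and> E s $ 3 = flat 4 s - 2 * flat 3 s \<and> E s $ 4 = flat 4 (-s) - 2 * flat 3 (-s)"
proof -
  obtain D where D: "\<forall>i. (\<lambda>s. D s $ i) \<in> elementary"
      "\<And>s. (bent_tangent has_vector_derivative D s) (at s)"
    using elementary_vec_derivative[OF bent_tangent_elementary] by blast
  obtain E where E: "\<And>s. (D has_vector_derivative E s) (at s)"
    using elementary_vec_derivative[OF D(1)] by blast
  have Dn: "((\<lambda>s. bent_tangent s $ i) has_real_derivative D s $ i) (at s)" for i s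
    using D(2) by (simp add: has_vector_derivative_vec_iff)
  have En: "((\<lambda>s. D s $ i) has_real_derivative E s $ i) (at s)" for i s
    using E by (simp add: has_vector_derivative_vec_iff)
  have D': "D s $ 2 = 1" "D s $ 3 = flat 2 s" "D s $ 4 = - flat 2 (-s)" for s
    using DERIV_unique[OF Dn[of 2 s, unfolded bent_tangent_nth] DERIV_ident]
      DERIV_unique[OF Dn[of 3 s, unfolded bent_tangent_nth] flat_0_derivatives(1)]
      DERIV_unique[OF Dn[of 4 s, unfolded bent_tangent_nth] flat_0_derivatives(2)] by auto
  have "E s $ 2 = 0" "E s $ 3 = flat 4 s - 2 * flat 3 s" "E s $ 4 = flat 4 (-s) - 2 * flat 3 (-s)" for s
    using DERIV_unique[OF En[of 2 s, unfolded D'] DERIV_const]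
      DERIV_unique[OF En[of 3 s, unfolded D'] flat_0_derivatives(3)]
      DERIV_unique[OF En[of 4 s, unfolded D'] flat_0_derivatives(4)] by auto
  with D(2) E D' show thesis using that by blast
qed

text \<open>Only the tangent enters, so any primitive of \<open>bent_tangent\<close> will do. On either side of \<open>0\<close> the
  tangent stays in a coordinate hyperplane, which then contains \<open>B\<close> too; at \<open>0\<close> both hyperplanes
  constrain \<open>B\<close>.\<close>

lemma no_type_F_frame:
  assumes tangent: "\<And>s. s \<in> {-1/2<..<1/2} \<Longrightarrow> tangent \<gamma> s = bent_tangent s"
  shows "\<not> generalized_Bishop_frame_F {-1/2<..<1/2} \<gamma> Z"
proof
  let ?I = "{-1/2<..<1/2::real}"
  assume "generalized_Bishop_frame_F ?I \<gamma> Z"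
  then obtain N B x1 x2 where
    T': "\<And>s. s \<in> ?I \<Longrightarrow> (tangent \<gamma> has_vector_derivative x1 s *\<^sub>R N s) (at s)" and
    N': "\<And>s. s \<in> ?I \<Longrightarrow> (N has_vector_derivative x1 s *\<^sub>R tangent \<gamma> s + x2 s *\<^sub>R B s) (at s)" and
    x1: "\<And>s. s \<in> ?I \<Longrightarrow> x1 differentiable (at s)" and
    B: "\<And>s. s \<in> ?I \<Longrightarrow> isCont B s" and
    orth: "\<And>s. s \<in> ?I \<Longrightarrow>
      lorentz (tangent \<gamma> s) (B s) = 0 \<and> lorentz (N s) (B s) = 0 \<and> lorentz (B s) (B s) = 1"
    by (rule type_F_normals[OF _ open_greaterThanLessThan]) blast
  obtain D E where
    D: "\<And>s. (bent_tangent has_vector_derivative D s) (at s)" and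
    E: "\<And>s. (D has_vector_derivative E s) (at s)" and
    Dn: "\<And>s. D s $ 2 = 1 \<and> D s $ 3 = flat 2 s \<and> D s $ 4 = - flat 2 (-s)" and
    En: "\<And>s. E s $ 2 = 0 \<and> E s $ 3 = flat 4 s - 2 * flat 3 s \<and> E s $ 4 = flat 4 (-s) - 2 * flat 3 (-s)"
    by (rule bent_tangent_derivatives) blast
  have tangent': "(tangent \<gamma> has_vector_derivative D s) (at s)" if "s \<in> ?I" for s
    by (rule has_vector_derivative_transform_within_open[OF D, of ?I]) (use that tangent in auto)
  have D0: "D s \<noteq> 0" for s using Dn[of s] by auto
  have second: "\<exists>a c. a > 0 \<and> E s = a *\<^sub>R bent_tangent s + c *\<^sub>R D s + (x1 s * x2 s) *\<^sub>R B s"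
    if "s \<in> ?I" for s
    using tangent_second_derivative[OF _ that T' N'[OF that] x1[OF that] tangent' D0 E] tangent[OF that]
    by simp
  \<comment> \<open>The second component of the relation \<open>second\<close> reads \<open>0 = a s + c + x\<^sub>1 x\<^sub>2 B\<^sub>2\<close>, hence
    \<open>c = - a s\<close> if \<open>x\<^sub>2 = 0\<close>.\<close>
  have right: "B s $ 4 = 0" if s: "0 < s" "s < 1/2" for s
  proof -
    have sI: "s \<in> ?I" using s by simp
    obtain a c where "a > 0" and e: "E s = a *\<^sub>R bent_tangent s + c *\<^sub>R D s + (x1 s * x2 s) *\<^sub>R B s"
      using second[OF sI] by blast
    have "x1 s * x2 s \<noteq> 0"
    proof
      assume *: "x1 s * x2 s = 0"
      have "c = - a * s" using arg_cong[OF e, of "\<lambda>v. v $ 2"] *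
        by (simp add: Dn En bent_tangent_nth)
      then have "flat 4 s - 2 * flat 3 s = a * (flat 0 s - s * flat 2 s)"
        using arg_cong[OF e, of "\<lambda>v. v $ 3"] * by (simp add: Dn En bent_tangent_nth algebra_simps)
      with flat_0_convex(1)[OF s] mult_pos_neg[OF \<open>a > 0\<close> flat_0_convex(2)[OF s]]
      show False by simp
    qed
    moreover have "(x1 s * x2 s) * B s $ 4 = 0"
      using arg_cong[OF e, of "\<lambda>v. v $ 4"] s by (simp add: Dn En bent_tangent_nth flat_def)
    ultimately show ?thesis by simp
  qed
  have left: "B s $ 3 = 0" if s: "-1/2 < s" "s < 0" for s
  proof -
    have sI: "s \<in> ?I" and s': "0 < - s" "- s < 1/2" using s by simp_all
    obtain a c where "a > 0" and e: "E s = a *\<^sub>R bent_tangent s + c *\<^sub>R D s + (x1 s * x2 s) *\<^sub>R B s"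
      using second[OF sI] by blast
    have "x1 s * x2 s \<noteq> 0"
    proof
      assume *: "x1 s * x2 s = 0"
      have "c = - a * s" using arg_cong[OF e, of "\<lambda>v. v $ 2"] *
        by (simp add: Dn En bent_tangent_nth)
      then have "flat 4 (-s) - 2 * flat 3 (-s) = a * (flat 0 (-s) - (-s) * flat 2 (-s))"
        using arg_cong[OF e, of "\<lambda>v. v $ 4"] * by (simp add: Dn En bent_tangent_nth algebra_simps)
      with flat_0_convex(1)[OF s'] mult_pos_neg[OF \<open>a > 0\<close> flat_0_convex(2)[OF s']]
      show False by simp
    qed
    moreover have "(x1 s * x2 s) * B s $ 3 = 0"
      using arg_cong[OF e, of "\<lambda>v. v $ 3"] s by (simp add: Dn En bent_tangent_nth flat_def)
    ultimately show ?thesis by simp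
  qed
  have B0: "isCont (\<lambda>s. B s $ i) 0" for i
    using B[of 0] by (simp add: continuous_component)
  have "B 0 $ 4 = 0"
  proof (rule tendsto_unique[of "at_right (0::real)"])
    show "((\<lambda>s. B s $ 4) \<longlongrightarrow> B 0 $ 4) (at_right 0)"
      using B0[of 4] unfolding isCont_def by (rule tendsto_within_subset) simp
    have "\<forall>\<^sub>F s in at_right (0::real). B s $ 4 = 0"
      by (rule eventually_mono[OF eventually_at_right_real[of 0 "1/2"]]) (simp_all add: right)
    then show "((\<lambda>s. B s $ 4) \<longlongrightarrow> 0) (at_right 0)"
      by (simp add: tendsto_eventually)
  qed simp
  moreover have "B 0 $ 3 = 0"
  proof (rule tendsto_unique[of "at_left (0::real)"])
    show "((\<lambda>s. B s $ 3) \<longlongrightarrow> B 0 $ 3) (at_left 0)"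
      using B0[of 3] unfolding isCont_def by (rule tendsto_within_subset) simp
    have "\<forall>\<^sub>F s in at_left (0::real). B s $ 3 = 0"
      by (rule eventually_mono[OF eventually_at_left_real[of "-1/2" 0]]) (simp_all add: left)
    then show "((\<lambda>s. B s $ 3) \<longlongrightarrow> 0) (at_left 0)"
      by (simp add: tendsto_eventually)
  qed simp
  moreover have "B 0 $ 1 = 0"
    using orth[of 0] tangent[of 0] by (simp add: lorentz_def bent_tangent_def flat_def)
  moreover have "B 0 $ 2 = 0"
  proof -
    have "D 0 = x1 0 *\<^sub>R N 0"
      by (rule vector_derivative_unique_at[OF tangent' T']) simp_all
    then have "x1 0 * N 0 $ 2 = 1" using Dn[of 0] by (metis vector_scaleR_component real_scaleR_def)
    then have "N 0 $ 2 \<noteq> 0" by auto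
    moreover have "lorentz (N 0) (B 0) = 0" using orth[of 0] by simp
    ultimately show ?thesis
      using \<open>B 0 $ 1 = 0\<close> \<open>B 0 $ 3 = 0\<close> \<open>B 0 $ 4 = 0\<close> by (simp add: lorentz_def)
  qed
  ultimately have "lorentz (B 0) (B 0) = 0" by (simp add: lorentz_def)
  with orth[of 0] show False by simp
qed

theorem theorem1p6:
  shows "\<exists>(I :: real set) (\<gamma> :: real \<Rightarrow> real^4).
     regular_timelike_curve I \<gamma> \<and> proper_time_parametrized I \<gamma> \<and> two_regular I \<gamma> \<and>
     \<not> (\<exists>Z. generalized_Bishop_frame_F I \<gamma> Z)"
proof -
  let ?I = "{-1/2<..<1/2::real}"
  define \<gamma> where "\<gamma> = (\<lambda>s. integral {-1..s} bent_tangent)"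
  have cont: "continuous_on {-1..1} bent_tangent"
    using elementary_vec_derivative[OF bent_tangent_elementary]
    by (meson continuous_at_imp_continuous_on has_vector_derivative_continuous)
  have \<gamma>': "(\<gamma> has_vector_derivative bent_tangent s) (at s)" if "s \<in> ?I" for s
  proof -
    have "s \<in> {-1..1}" and "s \<in> interior {-1..1}" using that by simp_all
    then show ?thesis
      using integral_has_vector_derivative[OF cont] unfolding \<gamma>_def
      by (metis at_within_interior)
  qed
  have tangent: "tangent \<gamma> s = bent_tangent s" if "s \<in> ?I" for s
    unfolding tangent_def using \<gamma>'[OF that] by (rule vector_derivative_at)
  \<comment> \<open>The primitive \<open>\<gamma>\<close> need not lie in the algebra componentwise, so it is added to the invariant.\<close>
  have "smooth_on ?I \<gamma>"
  proof (rule smooth_on_coinduct[where P = "\<lambda>v. v = \<gamma> \<or> (\<forall>i. (\<lambda>s. v s $ i) \<in> elementary)"])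
    fix g assume "g = \<gamma> \<or> (\<forall>i. (\<lambda>s. g s $ i) \<in> elementary)"
    then show "\<exists>g'. (g' = \<gamma> \<or> (\<forall>i. (\<lambda>s. g' s $ i) \<in> elementary)) \<and>
        (\<forall>s\<in>?I. (g has_vector_derivative g' s) (at s))"
      using elementary_vec_derivative[of g] \<gamma>' bent_tangent_elementary by blast
  qed simp_all
  then have "regular_timelike_curve ?I \<gamma>"
    by (auto simp: regular_timelike_curve_def open_interval_def tangent lorentz_bent_tangent
        is_interval_oo)
  moreover have "proper_time_parametrized ?I \<gamma>"
    by (simp add: proper_time_parametrized_def tangent lorentz_bent_tangent)
  moreover have "two_regular ?I \<gamma>"
    unfolding two_regular_def
  proof (intro ballI conjI)
    fix s assume s: "s \<in> ?I"
    show "tangent \<gamma> s \<noteq> 0"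
      using lorentz_bent_tangent[of s] by (auto simp: tangent[OF s] lorentz_def)
    obtain D where D: "\<And>s. (bent_tangent has_vector_derivative D s) (at s)" "\<And>s. D s $ 2 = 1"
      by (rule bent_tangent_derivatives) blast
    have "(tangent \<gamma> has_vector_derivative D s) (at s)"
      by (rule has_vector_derivative_transform_within_open[OF D(1), of ?I]) (use s tangent in auto)
    then show "vector_derivative (tangent \<gamma>) (at s) \<noteq> 0"
      using D(2)[of s] by (auto simp: vector_derivative_at)
  qed
  moreover have "\<not> (\<exists>Z. generalized_Bishop_frame_F ?I \<gamma> Z)"
    using no_type_F_frame[OF tangent] by blast
  ultimately show ?thesis by blast
qed

end
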